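(* Let $n\ge 1$ and let $A$ be an $n\times n$ alternating sign matrix. Then its term rank satisfies $$\rho(A)\ge \left\lceil 2\sqrt{n+1}-2\right\rceil.$$
   Context: An alternating sign matrix (ASM) is an $n\times n$ matrix with entries in $\{0,+1,-1\}$ such that in each row and each column the nonzero entries alternate in sign, beginning and ending with $+1$. The term rank $\rho(X)$ of a matrix $X$ is the maximum number of nonzero entries of $X$ no two of which lie in the same row or column (equivalently, the minimum number of rows and columns that together contain all nonzero entries of $X$). *)

theory Defs
  imports Complex_Main "Jordan_Normal_Form.Matrix"
begin

text \<open>For the list of entries of a line (row or column) of a matrix, read in order. Beginning and
  ending with \<open>1\<close> includes that the line has a nonzero entry.\<close>

definition alternating_line :: "int list \<Rightarrow> bool" where
  "alternating_line xs \<longleftrightarrow> (let ys = filter (\<lambda>x. x \<noteq> 0) xs in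
     ys \<noteq> [] \<and> hd ys = 1 \<and> last ys = 1 \<and> successively (\<lambda>x y. y = - x) ys)"

definition alternating_sign_matrix :: "nat \<Rightarrow> int mat \<Rightarrow> bool" where
  "alternating_sign_matrix n A \<longleftrightarrow>
     A \<in> carrier_mat n n \<and>
     (\<forall>i<n. \<forall>j<n. A $$ (i, j) \<in> {0, 1, -1}) \<and>
     (\<forall>i<n. alternating_line (list_of_vec (row A i))) \<and>
     (\<forall>j<n. alternating_line (list_of_vec (col A j)))"

definition nonzero_positions :: "'a::zero mat \<Rightarrow> (nat \<times> nat) set" where
  "nonzero_positions A = {(i, j). i < dim_row A \<and> j < dim_col A \<and> A $$ (i, j) \<noteq> 0}"

text \<open>Injectivity of the two projections on \<open>S\<close> says that no two positions in \<open>S\<close> share a row or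
  a column. The set under \<open>Max\<close> is finite and contains \<open>0\<close>, by the empty \<open>S\<close>.\<close>

definition term_rank :: "'a::zero mat \<Rightarrow> nat" where
  "term_rank A = Max {card S | S. S \<subseteq> nonzero_positions A \<and> inj_on fst S \<and> inj_on snd S}"

end

(* By Koenig's theorem, some e rows and f columns with e + f = rho contain all nonzero entries.
   Every line of A sums to 1, so the e rows sum to e, the f columns to f, and the whole matrix
   to n; by inclusion-exclusion the e x f block where they meet sums to e + f - n.
   As its entries are at least -1, n - e - f <= e f, that is n + 1 <= (e + 1) (f + 1), and
   AM-GM gives the bound.  Koenig's theorem follows from the submodularity of line covers,
   applied to an edge set that is minimal for its covering number. *)
theory Submission imports Defs begin

text \<open>Finiteness is demanded because \<open>card\<close> of an infinite set is 0, so an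
  infinite cover would count as free.\<close>

definition line_cover :: "('a \<times> 'b) set \<Rightarrow> 'a set \<Rightarrow> 'b set \<Rightarrow> bool" where
  "line_cover E R C \<longleftrightarrow> finite R \<and> finite C \<and> (\<forall>(a, b)\<in>E. a \<in> R \<or> b \<in> C)"

lemma line_cover_swap: "line_cover (prod.swap ` E) C R \<longleftrightarrow> line_cover E R C"
  by (auto simp: line_cover_def)

text \<open>If edges \<open>p\<close> and \<open>q\<close> met in a row \<open>x\<close>, the small
  covers of \<open>E - {p}\<close> and \<open>E - {q}\<close> could be recombined into two covers of
  \<open>E\<close>, at the cost of only one extra line in total. That is too few for both to reach
  \<open>k\<close>.\<close>

lemma critical_imp_inj_on_fst:
  assumes min: "\<And>R C. line_cover E R C \<Longrightarrow> k \<le> card R + card C"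
    and crit: "\<And>e. e \<in> E \<Longrightarrow> \<exists>R C. line_cover (E - {e}) R C \<and> card R + card C < k"
  shows "inj_on fst E"
proof (rule inj_onI, rule ccontr)
  fix p q assume p: "p \<in> E" and q: "q \<in> E" and "fst p = fst q" "p \<noteq> q"
  then obtain x y z where pq: "p = (x, y)" "q = (x, z)" and "y \<noteq> z"
    by (metis prod.collapse)
  obtain R1 C1 where 1: "line_cover (E - {p}) R1 C1" "card R1 + card C1 < k"
    using crit[OF p] by blast
  obtain R2 C2 where 2: "line_cover (E - {q}) R2 C2" "card R2 + card C2 < k"
    using crit[OF q] by blast
  have x1: "x \<notin> R1"
  proof
    assume "x \<in> R1"
    then have "line_cover E R1 C1" using 1(1) pq by (auto simp: line_cover_def)
    then show False using min 1(2) by fastforce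
  qed
  have x2: "x \<notin> R2"
  proof
    assume "x \<in> R2"
    then have "line_cover E R2 C2" using 2(1) pq by (auto simp: line_cover_def)
    then show False using min 2(2) by fastforce
  qed
  have fin: "finite R1" "finite R2" "finite C1" "finite C2"
    using 1(1) 2(1) by (auto simp: line_cover_def)
  \<comment> \<open>Each cover omits \<open>x\<close> but still covers the other edge, so it must do
    so by a column. Hence \<open>C1 \<union> C2\<close> catches \<open>p\<close> and
    \<open>q\<close>.\<close>
  have "y \<in> C2" "z \<in> C1"
    using 1(1) 2(1) p q pq \<open>y \<noteq> z\<close> x1 x2 by (auto simp: line_cover_def)
  then have "line_cover E (R1 \<inter> R2) (C1 \<union> C2)"
    using 1(1) 2(1) pq by (fastforce simp: line_cover_def)
  then have a: "k \<le> card (R1 \<inter> R2) + card (C1 \<union> C2)" by (rule min)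
  \<comment> \<open>Here the extra row \<open>x\<close> catches \<open>p\<close> and
    \<open>q\<close>; any other edge missed by \<open>R1 \<union> R2\<close> has its column in both
    \<open>C1\<close> and \<open>C2\<close>.\<close>
  have "line_cover E (insert x (R1 \<union> R2)) (C1 \<inter> C2)"
    using 1(1) 2(1) pq by (fastforce simp: line_cover_def)
  then have "k \<le> card (insert x (R1 \<union> R2)) + card (C1 \<inter> C2)" by (rule min)
  then have b: "k \<le> Suc (card (R1 \<union> R2)) + card (C1 \<inter> C2)"
    using x1 x2 fin by simp
  \<comment> \<open>The two new covers have at most 2(k - 1) + 1 lines together, but
    \<open>a\<close> and \<open>b\<close> require 2k.\<close>
  show False
    using a b 1(2) 2(2) card_Un_Int[OF fin(1,2)] card_Un_Int[OF fin(3,4)] by linarith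
qed

text \<open>Edges are deleted as long as \<open>k\<close> still bounds every cover from below; once
  no deletion is possible, the remaining edges form a matching. Stating \<open>k\<close> as a mere
  lower bound lets the hypothesis pass to the smaller set.\<close>

theorem koenig:
  assumes "finite E"
    and "\<And>R C. line_cover E R C \<Longrightarrow> k \<le> card R + card C"
  shows "\<exists>S\<subseteq>E. inj_on fst S \<and> inj_on snd S \<and> k \<le> card S"
  using assms
proof (induction E rule: finite_psubset_induct)
  case (psubset E)
  show ?case
  proof (cases "\<exists>e\<in>E. \<forall>R C. line_cover (E - {e}) R C \<longrightarrow> k \<le> card R + card C")
    case True
    then obtain e where "e \<in> E" "\<And>R C. line_cover (E - {e}) R C \<Longrightarrow> k \<le> card R + card C"
      by blast
    then show ?thesis using psubset.IH[of "E - {e}"] by blast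
  next
    case False
    then have crit: "\<exists>R C. line_cover (E - {e}) R C \<and> card R + card C < k" if "e \<in> E" for e
      using that by (meson not_le)
    have fst: "inj_on fst E"
      using psubset.prems crit by (rule critical_imp_inj_on_fst)
    have "inj_on fst (prod.swap ` E)"
    proof (rule critical_imp_inj_on_fst)
      show "k \<le> card C + card R" if "line_cover (prod.swap ` E) C R" for C R
        using that psubset.prems by (simp add: line_cover_swap add.commute)
      show "\<exists>C R. line_cover (prod.swap ` E - {e}) C R \<and> card C + card R < k"
        if e: "e \<in> prod.swap ` E" for e
      proof -
        obtain d where d: "d \<in> E" "e = prod.swap d" using e by blast
        have "prod.swap ` E - {e} = prod.swap ` (E - {d})"
          using d by (cases d) auto
        then show ?thesis
          using crit[OF d(1)] by (metis line_cover_swap add.commute)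
      qed
    qed
    then have snd: "inj_on snd E"
      by (fastforce simp: inj_on_def)
    \<comment> \<open>Taking the row of every edge is a cover, and it has \<open>card E\<close>
      lines since \<open>fst\<close> is injective on \<open>E\<close>.\<close>
    have "line_cover E (fst ` E) {}"
      using psubset.hyps by (force simp: line_cover_def)
    then have "k \<le> card E"
      using psubset.prems card_image[OF fst] by fastforce
    then show ?thesis using fst snd by blast
  qed
qed

lemma finite_nonzero_positions: "finite (nonzero_positions A)"
  by (rule finite_subset[of _ "{..<dim_row A} \<times> {..<dim_col A}"])
    (auto simp: nonzero_positions_def)

lemma card_le_term_rank:
  assumes "S \<subseteq> nonzero_positions A" "inj_on fst S" "inj_on snd S"
  shows "card S \<le> term_rank A"
  unfolding term_rank_def
proof (rule Max_ge)
  have "{card S | S. S \<subseteq> nonzero_positions A \<and> inj_on fst S \<and> inj_on snd S}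
      \<subseteq> card ` Pow (nonzero_positions A)" by blast
  then show "finite {card S | S. S \<subseteq> nonzero_positions A \<and> inj_on fst S \<and> inj_on snd S}"
    by (rule finite_subset) (simp add: finite_nonzero_positions)
qed (use assms in blast)

text \<open>Otherwise \<open>koenig\<close> with \<open>k = Suc (term_rank A)\<close> would yield a
  matching larger than the term rank.\<close>

lemma term_rank_cover:
  obtains R C where "line_cover (nonzero_positions A) R C" "card R + card C \<le> term_rank A"
proof -
  have "\<exists>R C. line_cover (nonzero_positions A) R C \<and> card R + card C \<le> term_rank A"
  proof (rule ccontr)
    assume "\<not> ?thesis"
    then have "Suc (term_rank A) \<le> card R + card C"
      if "line_cover (nonzero_positions A) R C" for R C
      using that by (meson not_less_eq_eq)
    from koenig[OF finite_nonzero_positions this] show False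
      using card_le_term_rank not_less_eq_eq by (metis le_trans)
  qed
  then show thesis using that by blast
qed

text \<open>In twice the sum, neighbouring entries cancel in pairs and one copy of each end is left.
  Doubling avoids a case split on the parity of the length.\<close>

lemma double_sum_list_alternating:
  fixes ys :: "int list"
  assumes "ys \<noteq> []" "successively (\<lambda>x y. y = - x) ys"
  shows "2 * sum_list ys = hd ys + last ys"
  using assms
proof (induction ys)
  case (Cons x xs)
  then show ?case by (cases xs) auto
qed simp

lemma sum_list_alternating_line:
  assumes "alternating_line xs"
  shows "sum_list xs = 1"
proof -
  have "sum_list xs = sum_list (filter (\<lambda>x. x \<noteq> 0) xs)"
    by (induction xs) auto
  with assms double_sum_list_alternating[of "filter (\<lambda>x. x \<noteq> 0) xs"] show ?thesis
    by (auto simp: alternating_line_def Let_def)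
qed

lemma sum_list_list_of_vec: "sum_list (list_of_vec v) = (\<Sum>i<dim_vec v. v $ i)"
  by (simp add: sum_list_sum_nth list_of_vec_index length_list_of_vec lessThan_atLeast0)

lemma asm_row_sum:
  assumes "alternating_sign_matrix n A" "i < n"
  shows "(\<Sum>j<n. A $$ (i, j)) = 1"
proof -
  have A: "A \<in> carrier_mat n n" and "alternating_line (list_of_vec (row A i))"
    using assms by (auto simp: alternating_sign_matrix_def)
  from sum_list_alternating_line[OF this(2)] show ?thesis
    using A assms(2) by (simp add: sum_list_list_of_vec)
qed

lemma asm_col_sum:
  assumes "alternating_sign_matrix n A" "j < n"
  shows "(\<Sum>i<n. A $$ (i, j)) = 1"
proof -
  have A: "A \<in> carrier_mat n n" and "alternating_line (list_of_vec (col A j))"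
    using assms by (auto simp: alternating_sign_matrix_def)
  from sum_list_alternating_line[OF this(2)] show ?thesis
    using A assms(2) by (simp add: sum_list_list_of_vec)
qed

lemma asm_line_cover:
  assumes A: "alternating_sign_matrix n A"
    and cover: "line_cover (nonzero_positions A) R C"
  shows "n + 1 \<le> (card R + 1) * (card C + 1)"
proof -
  \<comment> \<open>A cover may contain indices outside the matrix, where no line sums are
    available. Truncation keeps the covering property and does not increase the
    cardinalities.\<close>
  define R' where "R' = R \<inter> {..<n}"
  define C' where "C' = C \<inter> {..<n}"
  have fin: "finite R" "finite C" using cover by (auto simp: line_cover_def)
  have sub: "R' \<subseteq> {..<n}" "C' \<subseteq> {..<n}" by (auto simp: R'_def C'_def)
  have cards: "card R' \<le> card R" "card C' \<le> card C"
    using fin by (auto simp: R'_def C'_def intro: card_mono)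
  have dim: "A \<in> carrier_mat n n" using A by (simp add: alternating_sign_matrix_def)
  have zero: "A $$ (i, j) = 0" if "i \<in> {..<n} - R'" "j \<in> {..<n} - C'" for i j
    using cover that dim unfolding line_cover_def nonzero_positions_def R'_def C'_def by force
  have "int n = (\<Sum>i<n. \<Sum>j<n. A $$ (i, j))"
    using asm_row_sum[OF A] by simp
  also have "\<dots> = (\<Sum>i\<in>R'. \<Sum>j<n. A $$ (i, j)) + (\<Sum>i\<in>{..<n} - R'. \<Sum>j<n. A $$ (i, j))"
    using sum.subset_diff[OF sub(1)] by (simp add: add.commute)
  also have "(\<Sum>i\<in>R'. \<Sum>j<n. A $$ (i, j)) = int (card R')"
    using asm_row_sum[OF A] sub(1) by (simp add: subset_iff)
  also have "(\<Sum>i\<in>{..<n} - R'. \<Sum>j<n. A $$ (i, j)) = (\<Sum>i\<in>{..<n} - R'. \<Sum>j\<in>C'. A $$ (i, j))"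
    by (intro sum.cong refl sum.mono_neutral_right) (use sub(2) zero in auto)
  also have "\<dots> = (\<Sum>j\<in>C'. \<Sum>i\<in>{..<n} - R'. A $$ (i, j))"
    by (rule sum.swap)
  \<comment> \<open>Completing each column to its full sum 1 brings in the block where
    \<open>R'\<close> and \<open>C'\<close> meet.\<close>
  also have "\<dots> = (\<Sum>j\<in>C'. 1 - (\<Sum>i\<in>R'. A $$ (i, j)))"
    using asm_col_sum[OF A] sub by (intro sum.cong refl) (auto simp: sum_diff subset_iff)
  also have "\<dots> \<le> (\<Sum>j\<in>C'. 1 + int (card R'))"
  proof (rule sum_mono)
    fix j assume j: "j \<in> C'"
    have "(\<Sum>i\<in>R'. - 1) \<le> (\<Sum>i\<in>R'. A $$ (i, j))"
    proof (rule sum_mono)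
      fix i assume "i \<in> R'"
      then have "A $$ (i, j) \<in> {0, 1, -1}"
        using A j sub by (auto simp: alternating_sign_matrix_def)
      then show "- 1 \<le> A $$ (i, j)" by auto
    qed
    then show "1 - (\<Sum>i\<in>R'. A $$ (i, j)) \<le> 1 + int (card R')" by simp
  qed
  \<comment> \<open>The chain gives n \<le> r + c (1 + r) for the sizes r, c of \<open>R'\<close>,
    \<open>C'\<close>; adding 1 makes the right side factor.\<close>
  finally have "int n + 1 \<le> int ((card R' + 1) * (card C' + 1))"
    by (simp add: algebra_simps)
  then have "n + 1 \<le> (card R' + 1) * (card C' + 1)" by linarith
  also have "\<dots> \<le> (card R + 1) * (card C + 1)"
    using cards by (intro mult_mono) auto
  finally show ?thesis .
qed

theorem theorem4p1:
  fixes n :: nat and A :: "int mat"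
  assumes "n \<ge> 1"
    and "alternating_sign_matrix n A"
  shows "int (term_rank A) \<ge> \<lceil>2 * sqrt (real n + 1) - 2\<rceil>"
proof -
  obtain R C where cover: "line_cover (nonzero_positions A) R C"
    and le: "card R + card C \<le> term_rank A"
    by (rule term_rank_cover)
  let ?a = "real (card R + 1)" and ?b = "real (card C + 1)"
  have "real (n + 1) \<le> real ((card R + 1) * (card C + 1))"
    using asm_line_cover[OF assms(2) cover] by (simp only: of_nat_le_iff)
  then have "sqrt (real n + 1) \<le> sqrt (?a * ?b)"
    by (simp only: of_nat_mult of_nat_add of_nat_1 real_sqrt_le_mono)
  also have "\<dots> \<le> (?a + ?b) / 2"
    by (rule arith_geo_mean_sqrt) auto
  \<comment> \<open>The two shifts by 1 in \<open>?a\<close> and \<open>?b\<close> account for the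
    -2.\<close>
  finally have "2 * sqrt (real n + 1) - 2 \<le> real (card R + card C)"
    by simp
  also have "\<dots> \<le> real (term_rank A)" using le by simp
  finally show ?thesis by (subst ceiling_le_iff) simp
qed

end
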